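(* Let $\mathcal K\subset\mathbb{R}^5$ be the convex polyhedral cone of all $(q_1,q_2,q_3,q_4,q_5)$ satisfying $$q_1,\dots,q_5\ge0,\qquad q_1+q_2+q_3+q_4-2q_5\ge0,$$ $$\sum_{j\in\{1,2,3,4\},\,j\neq i}q_j-q_5\ge0\quad(i=1,\dots,4),\qquad q_i+4\sum_{j\in\{1,2,3,4\},\,j\ne i}q_j-4q_5\ge0\quad(i=1,\dots,4)$$ (the constraints produced by the four-party sieve). Then the extremal rays of $\mathcal K$ are, up to permutations of $q_1,q_2,q_3,q_4$, exactly those spanned by $(1,0,0,0,0)$ and $(1,1,0,0,1)$. Under the correspondence $$(q_1,\dots,q_5)\ \longmapsto\ -q_1\mathbf I_3^{ABC}-q_2\mathbf I_3^{ABD}-q_3\mathbf I_3^{ACD}-q_4\mathbf I_3^{BCD}+q_5\mathbf I_4^{ABCD},$$ these two rays correspond to $-\mathbf I_3(A:B:C)$ and $-\mathbf I_3(CD:A:B)$ respectively, i.e. to instances of monogamy of mutual information.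
   Context: For a set of colors $J\subseteq\{A,B,C,D\}$, $\mathbf I_{|J|}^{J}=\sum_{\emptyset\ne K\subseteq J}(-1)^{|K|+1}S_K$, where the $S_K$ are formal basis variables indexed by the nonempty subsets $K$ of $\{A,B,C,D\}$. The tripartite information is $\mathbf I_3(X:Y:Z)=S_X+S_Y+S_Z-S_{XY}-S_{XZ}-S_{YZ}+S_{XYZ}$ for pairwise disjoint nonempty sets of colors $X,Y,Z$ (juxtaposition denotes union). An extremal ray of a pointed convex cone is a one-dimensional face. *)

theory Defs
  imports "HOL-Analysis.Analysis" "HOL-Combinatorics.Permutations"
begin

section \<open>The sieve cone\<close>

text \<open>In the index type \<^typ>\<open>5\<close> the numerals \<open>1, 2, 3, 4, 5\<close> are pairwise distinct (and \<open>5 = 0\<close>),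
  so \<open>q $ 1, \<dots>, q $ 5\<close> are the five coordinates of \<open>q\<close>.\<close>

definition sieve_cone :: "(real ^ 5) set" where
  "sieve_cone = {q.
     (\<forall>i. 0 \<le> q $ i) \<and>
     0 \<le> q $ 1 + q $ 2 + q $ 3 + q $ 4 - 2 * q $ 5 \<and>
     (\<forall>i\<in>{1, 2, 3, 4}. 0 \<le> (\<Sum>j\<in>{1, 2, 3, 4} - {i}. q $ j) - q $ 5) \<and>
     (\<forall>i\<in>{1, 2, 3, 4}. 0 \<le> q $ i + 4 * (\<Sum>j\<in>{1, 2, 3, 4} - {i}. q $ j) - 4 * q $ 5)}"

definition pointed :: "'a::real_vector set \<Rightarrow> bool" where
  "pointed K \<longleftrightarrow> K \<inter> uminus ` K = {0}"

definition extremal_ray :: "'a::euclidean_space set \<Rightarrow> 'a set \<Rightarrow> bool" where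
  "extremal_ray K R \<longleftrightarrow> R face_of K \<and> aff_dim R = 1"

text \<open>For the index type 5, a permutation \<open>p\<close> of \<open>{1, 2, 3, 4}\<close> fixes the index \<open>5\<close>.\<close>

definition permute_coords :: "('n \<Rightarrow> 'n) \<Rightarrow> real ^ 'n \<Rightarrow> real ^ 'n" where
  "permute_coords p q = (\<chi> i. q $ p i)"

lemma index5_distinct:
  "(1::5) \<noteq> 2" "(1::5) \<noteq> 3" "(1::5) \<noteq> 4" "(1::5) \<noteq> 5" "(2::5) \<noteq> 3" "(2::5) \<noteq> 4"
  "(2::5) \<noteq> 5" "(3::5) \<noteq> 4" "(3::5) \<noteq> 5" "(4::5) \<noteq> 5"
  by simp_all

lemma UNIV_5: "(UNIV :: 5 set) = {1, 2, 3, 4, 5}"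
proof -
  have "card {1, 2, 3, 4, 5 :: 5} = CARD(5)"
    by simp
  then show ?thesis
    by (metis card_subset_eq finite_code top_greatest)
qed

lemma vector_5:
  "(vector [a, b, c, d, e] :: 'a::zero ^ 5) $ 1 = a"
  "(vector [a, b, c, d, e] :: 'a::zero ^ 5) $ 2 = b"
  "(vector [a, b, c, d, e] :: 'a::zero ^ 5) $ 3 = c"
  "(vector [a, b, c, d, e] :: 'a::zero ^ 5) $ 4 = d"
  "(vector [a, b, c, d, e] :: 'a::zero ^ 5) $ 5 = e"
  by (simp_all add: vector_def)

lemma sieve_cone_iff:
  "q \<in> sieve_cone \<longleftrightarrow>
     0 \<le> q $ 1 \<and> 0 \<le> q $ 2 \<and> 0 \<le> q $ 3 \<and> 0 \<le> q $ 4 \<and> 0 \<le> q $ 5 \<and>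
     0 \<le> q $ 1 + q $ 2 + q $ 3 + q $ 4 - 2 * q $ 5 \<and>
     0 \<le> q $ 2 + q $ 3 + q $ 4 - q $ 5 \<and>
     0 \<le> q $ 1 + q $ 3 + q $ 4 - q $ 5 \<and>
     0 \<le> q $ 1 + q $ 2 + q $ 4 - q $ 5 \<and>
     0 \<le> q $ 1 + q $ 2 + q $ 3 - q $ 5 \<and>
     0 \<le> q $ 1 + 4 * (q $ 2 + q $ 3 + q $ 4) - 4 * q $ 5 \<and>
     0 \<le> q $ 2 + 4 * (q $ 1 + q $ 3 + q $ 4) - 4 * q $ 5 \<and>
     0 \<le> q $ 3 + 4 * (q $ 1 + q $ 2 + q $ 4) - 4 * q $ 5 \<and>
     0 \<le> q $ 4 + 4 * (q $ 1 + q $ 2 + q $ 3) - 4 * q $ 5"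
proof -
  have all5: "(\<forall>i::5. P i) \<longleftrightarrow> P 1 \<and> P 2 \<and> P 3 \<and> P 4 \<and> P 5" for P
    by (metis (full_types) UNIV_5 UNIV_I empty_iff insert_iff)
  show ?thesis
    unfolding sieve_cone_def mem_Collect_eq all5
    by (simp add: insert_Diff_if algebra_simps)
qed

lemma polyhedron_nonneg_linear:
  fixes f :: "'a::euclidean_space \<Rightarrow> real"
  assumes "linear f"
  shows "polyhedron {x. 0 \<le> f x}"
proof -
  have "f x = adjoint f 1 \<bullet> x" for x
    using adjoint_works [OF assms, of x 1] by (simp add: inner_commute)
  then show ?thesis
    using polyhedron_halfspace_ge [of 0 "adjoint f 1"] by simp
qed

lemma polyhedron_sieve_cone: "polyhedron sieve_cone"
proof -
  have nth: "polyhedron {q :: real ^ 5. 0 \<le> q $ i}" for i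
    by (intro polyhedron_nonneg_linear linearI) simp_all
  have total: "polyhedron {q :: real ^ 5. 0 \<le> q $ 1 + q $ 2 + q $ 3 + q $ 4 - 2 * q $ 5}"
    by (intro polyhedron_nonneg_linear linearI) (simp_all add: algebra_simps)
  have three: "polyhedron {q :: real ^ 5. 0 \<le> (\<Sum>j\<in>J. q $ j) - q $ 5}" for J
    by (intro polyhedron_nonneg_linear linearI)
      (simp_all add: sum.distrib sum_distrib_left algebra_simps)
  have four: "polyhedron {q :: real ^ 5. 0 \<le> q $ i + 4 * (\<Sum>j\<in>J. q $ j) - 4 * q $ 5}" for i J
    by (intro polyhedron_nonneg_linear linearI)
      (simp_all add: sum.distrib algebra_simps flip: sum_distrib_left)
  have "sieve_cone =
      (\<Inter>i\<in>UNIV. {q. 0 \<le> q $ i}) \<inter>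
      {q. 0 \<le> q $ 1 + q $ 2 + q $ 3 + q $ 4 - 2 * q $ 5} \<inter>
      (\<Inter>i\<in>{1, 2, 3, 4}. {q. 0 \<le> (\<Sum>j\<in>{1, 2, 3, 4} - {i}. q $ j) - q $ 5}) \<inter>
      (\<Inter>i\<in>{1, 2, 3, 4}.
        {q. 0 \<le> q $ i + 4 * (\<Sum>j\<in>{1, 2, 3, 4} - {i}. q $ j) - 4 * q $ 5})"
    unfolding sieve_cone_def by (intro set_eqI) (simp only: Int_iff INT_iff mem_Collect_eq UNIV_I simp_thms
        Ball_def conj_assoc)
  also have "polyhedron \<dots>"
    by (intro polyhedron_Int polyhedron_Inter total finite_imageI finite finite.intros)
      (elim imageE, simp only: nth three four)+
  finally show ?thesis .
qed

lemma convex_sieve_cone: "convex sieve_cone"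
  by (rule polyhedron_imp_convex [OF polyhedron_sieve_cone])

lemma conic_sieve_cone: "conic sieve_cone"
proof -
  show ?thesis
    unfolding conic_def sieve_cone_def
  proof (intro allI impI)
    fix q :: "real ^ 5" and c :: real
    assume q: "q \<in> {q. (\<forall>i. 0 \<le> q $ i) \<and>
       0 \<le> q $ 1 + q $ 2 + q $ 3 + q $ 4 - 2 * q $ 5 \<and>
       (\<forall>i\<in>{1, 2, 3, 4}. 0 \<le> (\<Sum>j\<in>{1, 2, 3, 4} - {i}. q $ j) - q $ 5) \<and>
       (\<forall>i\<in>{1, 2, 3, 4}. 0 \<le> q $ i + 4 * (\<Sum>j\<in>{1, 2, 3, 4} - {i}. q $ j) - 4 * q $ 5)}"
      and c: "0 \<le> c"
    have 1: "(\<Sum>j\<in>J. (c *\<^sub>R q) $ j) - (c *\<^sub>R q) $ 5 = c * ((\<Sum>j\<in>J. q $ j) - q $ 5)" for J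
      by (simp add: right_diff_distrib sum_distrib_left)
    have 2: "(c *\<^sub>R q) $ i + 4 * (\<Sum>j\<in>J. (c *\<^sub>R q) $ j) - 4 * (c *\<^sub>R q) $ 5
        = c * (q $ i + 4 * (\<Sum>j\<in>J. q $ j) - 4 * q $ 5)" for i J
      by (simp add: algebra_simps flip: sum_distrib_left)
    have 3: "(c *\<^sub>R q) $ 1 + (c *\<^sub>R q) $ 2 + (c *\<^sub>R q) $ 3 + (c *\<^sub>R q) $ 4 - 2 * (c *\<^sub>R q) $ 5
        = c * (q $ 1 + q $ 2 + q $ 3 + q $ 4 - 2 * q $ 5)"
      by (simp add: algebra_simps)
    show "c *\<^sub>R q \<in> {q. (\<forall>i. 0 \<le> q $ i) \<and>
       0 \<le> q $ 1 + q $ 2 + q $ 3 + q $ 4 - 2 * q $ 5 \<and>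
       (\<forall>i\<in>{1, 2, 3, 4}. 0 \<le> (\<Sum>j\<in>{1, 2, 3, 4} - {i}. q $ j) - q $ 5) \<and>
       (\<forall>i\<in>{1, 2, 3, 4}. 0 \<le> q $ i + 4 * (\<Sum>j\<in>{1, 2, 3, 4} - {i}. q $ j) - 4 * q $ 5)}"
      unfolding mem_Collect_eq 1 2 3
      using q c by (simp del: insert_iff)
  qed
qed

lemma pointed_sieve_cone: "pointed sieve_cone"
proof -
  have "q = 0" if "q \<in> sieve_cone" "- q \<in> sieve_cone" for q
    using that unfolding sieve_cone_def vec_eq_iff by (force intro: antisym)
  moreover have "0 \<in> sieve_cone"
    by (simp add: sieve_cone_def)
  ultimately show ?thesis
    unfolding pointed_def by force
qed


section \<open>Information quantities\<close>

datatype color = A | B | C | D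

lemma UNIV_color: "UNIV = {A, B, C, D}"
  using color.exhaust by blast

instance color :: finite
  by standard (simp add: UNIV_color)

typedef subsystem = "{K :: color set. K \<noteq> {}}"
  by blast

instance subsystem :: finite
proof
  have "inj Rep_subsystem"
    by (simp add: inj_def Rep_subsystem_inject)
  then show "finite (UNIV :: subsystem set)"
    by (rule finite_imageD [rotated]) simp
qed

text \<open>The real vector space with the \<open>S K\<close>, \<open>K\<close> nonempty, as formal basis. The value at the
  empty set is the junk value 0.\<close>

type_synonym entropy_space = "real ^ subsystem"

definition S :: "color set \<Rightarrow> entropy_space" where
  "S K = (\<chi> L. if Rep_subsystem L = K then 1 else 0)"

lemma S_eq_axis: "K \<noteq> {} \<Longrightarrow> S K = axis (Abs_subsystem K) 1"
  by (auto simp: S_def axis_def vec_eq_iff Abs_subsystem_inverse Rep_subsystem_inverse)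

definition multi_info :: "color set \<Rightarrow> entropy_space" where
  "multi_info J = (\<Sum>K | K \<noteq> {} \<and> K \<subseteq> J. (-1) ^ (card K + 1) *\<^sub>R S K)"

definition tripartite_info :: "color set \<Rightarrow> color set \<Rightarrow> color set \<Rightarrow> entropy_space" where
  "tripartite_info X Y Z =
     S X + S Y + S Z - S (X \<union> Y) - S (X \<union> Z) - S (Y \<union> Z) + S (X \<union> Y \<union> Z)"

text \<open>Monogamy of mutual information is the inequality \<open>- I\<^sub>3(X:Y:Z) \<ge> 0\<close>; an instance of it is
  represented by its left-hand side.\<close>

definition mmi_instance :: "entropy_space \<Rightarrow> bool" where
  "mmi_instance v \<longleftrightarrow> (\<exists>X Y Z. X \<noteq> {} \<and> Y \<noteq> {} \<and> Z \<noteq> {} \<and>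
     X \<inter> Y = {} \<and> X \<inter> Z = {} \<and> Y \<inter> Z = {} \<and> v = - tripartite_info X Y Z)"

definition info_quantity :: "real ^ 5 \<Rightarrow> entropy_space" where
  "info_quantity q =
     - (q $ 1) *\<^sub>R multi_info {A, B, C} - (q $ 2) *\<^sub>R multi_info {A, B, D}
     - (q $ 3) *\<^sub>R multi_info {A, C, D} - (q $ 4) *\<^sub>R multi_info {B, C, D}
     + (q $ 5) *\<^sub>R multi_info {A, B, C, D}"

lemma linear_info_quantity: "linear info_quantity"
  by (rule linearI) (simp_all add: info_quantity_def algebra_simps)

end

(* From every nonzero point q of the cone a positive multiple of one of the claimed generators can
   be split off. Order the first four coordinates decreasingly, at positions i, j, k, l. If
   q_1 + q_2 + q_3 + q_4 > 2 q_5, a multiple of the unit vector at i can be subtracted; if equality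
   holds, a multiple of the vector with ones at i, j and 5. Hence a one-dimensional face contains a
   generator, and it is the ray of that generator, because this ray is itself a face and proper
   faces have smaller dimension. *)

theory Submission
  imports Defs
begin

section \<open>Extremal rays\<close>

text \<open>By Riesz representation \<open>f\<close> is the inner product with
  \<open>adjoint f 1\<close>, so its zero set is a supporting hyperplane of
  \<open>K\<close>.\<close>

lemma face_of_Int_linear_zero:
  fixes f :: "'a::euclidean_space \<Rightarrow> real"
  assumes "convex K" "linear f" "\<And>x. x \<in> K \<Longrightarrow> 0 \<le> f x"
  shows "(K \<inter> {x. f x = 0}) face_of K"
proof -
  have f: "f x = adjoint f 1 \<bullet> x" for x
    using adjoint_works [OF assms(2), of x 1] by (simp add: inner_commute)
  show ?thesis
    using face_of_Int_supporting_hyperplane_ge [of K 0 "adjoint f 1"] assms(1,3)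
    by (simp flip: f)
qed

text \<open>The ray contains 0, so its affine dimension is its linear dimension, and it has the same
  span as \<open>g\<close>.\<close>

lemma aff_dim_conic_hull_singleton:
  fixes g :: "'a::euclidean_space"
  assumes "g \<noteq> 0"
  shows "aff_dim (conic hull {g}) = 1"
proof -
  have "span (conic hull {g}) = span {g}"
  proof (rule antisym)
    show "span (conic hull {g}) \<subseteq> span {g}"
      by (intro span_minimal subspace_span) (auto simp: conic_hull_explicit intro: span_scale span_base)
    show "span {g} \<subseteq> span (conic hull {g})"
      by (intro span_mono hull_subset)
  qed
  then have "dim (conic hull {g}) = dim {g}"
    by (metis dim_span)
  moreover have "0 \<in> conic hull {g}"
    by (auto simp: conic_hull_explicit intro: exI [of _ 0])
  ultimately show ?thesis
    using assms by (simp add: aff_dim_zero hull_inc)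
qed

text \<open>Reduces the classification to two checks on candidates: \<open>split\<close> puts a
  candidate into every one-dimensional face, and \<open>face\<close> shows that this face is no
  larger than the candidate's ray.\<close>

lemma extremal_rays_eqI:
  fixes K :: "'a::euclidean_space set"
  assumes "convex K" "conic K" "G \<subseteq> K - {0}"
    and face: "\<And>g. g \<in> G \<Longrightarrow> (conic hull {g}) face_of K"
    and split: "\<And>q. q \<in> K \<Longrightarrow> q \<noteq> 0 \<Longrightarrow> \<exists>g\<in>G. \<exists>t>0. q - t *\<^sub>R g \<in> K"
  shows "{R. extremal_ray K R} = {conic hull {g} | g. g \<in> G}"
proof (intro set_eqI iffI)
  fix R
  assume "R \<in> {R. extremal_ray K R}"
  then have R: "R face_of K" and dim: "aff_dim R = 1"
    by (auto simp: extremal_ray_def)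
  have conicR: "conic R"
    using face_of_conic \<open>conic K\<close> R by blast
  have "\<not> R \<subseteq> {0}"
    using aff_dim_subset [of R "{0}"] dim by auto
  then obtain q where q: "q \<in> R" "q \<noteq> 0" by blast
  then have "q \<in> K"
    using R face_of_imp_subset by blast
  then obtain g t where g: "g \<in> G" and t: "0 < t" and qt: "q - t *\<^sub>R g \<in> K"
    using split q by blast
  \<comment> \<open>The summands of \<open>q = (q - t *\<^sub>R g) + t *\<^sub>R g\<close> are
    doubled to make \<open>q\<close> their midpoint; a face containing \<open>q\<close> then
    contains both ends.\<close>
  define a b where "a = 2 *\<^sub>R (q - t *\<^sub>R g)" and "b = (2 * t) *\<^sub>R g"
  have K: "a \<in> K" "b \<in> K"
    using \<open>conic K\<close> qt g t assms(3) by (auto simp: conic_def a_def b_def)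
  have mid: "midpoint a b = q"
    by (simp add: midpoint_def a_def b_def algebra_simps)
  have "b \<in> R"
  \<comment> \<open>If \<open>a = b\<close>, the open segment is empty and the face property says
    nothing, but then \<open>b\<close> is \<open>q\<close> itself.\<close>
  proof (cases "a = b")
    case True
    then show ?thesis
      using mid q by simp
  next
    case False
    then show ?thesis
      using face_ofD [OF R _ K q(1)] mid midpoint_in_open_segment [of a b] by simp
  qed
  then have "(1 / (2 * t)) *\<^sub>R b \<in> R"
    using conicR t by (simp add: conic_def)
  then have "g \<in> R"
    using t by (simp add: b_def)
  then have sub: "conic hull {g} \<subseteq> R"
    using conicR by (intro hull_minimal) auto
  \<comment> \<open>A face of \<open>K\<close> inside \<open>R\<close> is a face of
    \<open>R\<close>, and a proper face would have smaller dimension.\<close>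
  have "(conic hull {g}) face_of R"
    using face_of_subset [OF face [OF g] sub] R face_of_imp_subset by blast
  moreover have "aff_dim (conic hull {g}) = aff_dim R"
    using dim aff_dim_conic_hull_singleton [of g] g assms(3) by auto
  ultimately have "R = conic hull {g}"
    using face_of_aff_dim_lt [of R "conic hull {g}"] face_of_imp_convex [OF R]
    by (metis order_less_irrefl)
  then show "R \<in> {conic hull {g} | g. g \<in> G}"
    using g by blast
next
  fix R
  assume "R \<in> {conic hull {g} | g. g \<in> G}"
  then obtain g where "R = conic hull {g}" "g \<in> G" by blast
  then show "R \<in> {R. extremal_ray K R}"
    using face aff_dim_conic_hull_singleton [of g] assms(3) by (auto simp: extremal_ray_def)
qed

section \<open>The sieve cone\<close>

text \<open>Naming the first four coordinates in arbitrary order lets each argument below cover all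
  permutations at once.\<close>

definition enumerates :: "5 \<Rightarrow> 5 \<Rightarrow> 5 \<Rightarrow> 5 \<Rightarrow> bool" where
  "enumerates i j k l \<longleftrightarrow> distinct [i, j, k, l] \<and> {i, j, k, l} = {1, 2, 3, 4}"

lemma enumerates_neq_5:
  assumes "enumerates i j k l"
  shows "i \<noteq> 5" "j \<noteq> 5" "k \<noteq> 5" "l \<noteq> 5"
proof -
  have "5 \<notin> {i, j, k, l}"
    using assms unfolding enumerates_def by simp
  then show "i \<noteq> 5" "j \<noteq> 5" "k \<noteq> 5" "l \<noteq> 5"
    by auto
qed

lemma enumerates_vec_eq_iff:
  fixes x y :: "real ^ 5"
  assumes "enumerates i j k l"
  shows "x = y \<longleftrightarrow> x $ i = y $ i \<and> x $ j = y $ j \<and> x $ k = y $ k \<and> x $ l = y $ l \<and> x $ 5 = y $ 5"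
proof -
  have "UNIV = {i, j, k, l} \<union> {5 :: 5}"
    using assms unfolding enumerates_def by (simp add: UNIV_5 insert_commute)
  then have "(\<forall>m. P m) \<longleftrightarrow> P i \<and> P j \<and> P k \<and> P l \<and> P 5" for P :: "5 \<Rightarrow> bool"
    by (metis UNIV_I Un_iff insert_iff empty_iff)
  then show ?thesis
    unfolding vec_eq_iff .
qed

text \<open>The inequalities with coefficient 4 are implied by the other ones.\<close>

lemma sieve_cone_enumerates_iff:
  assumes "enumerates i j k l"
  shows "q \<in> sieve_cone \<longleftrightarrow>
     0 \<le> q $ i \<and> 0 \<le> q $ j \<and> 0 \<le> q $ k \<and> 0 \<le> q $ l \<and> 0 \<le> q $ 5 \<and>
     2 * q $ 5 \<le> q $ i + q $ j + q $ k + q $ l \<and>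
     q $ 5 \<le> q $ j + q $ k + q $ l \<and> q $ 5 \<le> q $ i + q $ k + q $ l \<and>
     q $ 5 \<le> q $ i + q $ j + q $ l \<and> q $ 5 \<le> q $ i + q $ j + q $ k"
proof -
  define s where "s = (\<Sum>m\<in>{1, 2, 3, 4}. q $ m)"
  have s: "s = q $ 1 + q $ 2 + q $ 3 + q $ 4"
    by (simp add: s_def)
  have I: "{1, 2, 3, 4} = {i, j, k, l}" and "distinct [i, j, k, l]"
    using assms by (simp_all add: enumerates_def)
  then have s': "s = q $ i + q $ j + q $ k + q $ l"
    unfolding s_def I by simp
  \<comment> \<open>In terms of the symmetric total \<open>s\<close>, each constraint mentions at
    most one index \<open>m\<close>, so the index set can be rewritten. The coefficient-4 expression
    is \<open>q $ m + 4 * (s - q $ m - q $ 5)\<close>, a sum of nonnegative terms.\<close>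
  have "q \<in> sieve_cone \<longleftrightarrow> (\<forall>m\<in>{1, 2, 3, 4}. 0 \<le> q $ m \<and> q $ 5 \<le> s - q $ m) \<and> 0 \<le> q $ 5 \<and> 2 * q $ 5 \<le> s"
    unfolding sieve_cone_iff s by auto
  then show ?thesis
    unfolding I by (auto simp: s')
qed

lemma sorted_enumeration:
  fixes f :: "5 \<Rightarrow> real"
  obtains i j k l where "enumerates i j k l" "f l \<le> f k" "f k \<le> f j" "f j \<le> f i"
proof -
  define xs where "xs = sort_key f [1, 2, 3, 4]"
  have xs: "length xs = 4" "distinct xs" "set xs = {1, 2, 3, 4}" "sorted (map f xs)"
    by (simp_all add: xs_def del: sort_key_simps)
  \<comment> \<open>Sorting is increasing, so the names are assigned in reverse.\<close>
  then obtain l k j i where "xs = [l, k, j, i]"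
    by (auto simp: length_Suc_conv numeral_eq_Suc)
  with xs have "enumerates i j k l" "f l \<le> f k" "f k \<le> f j" "f j \<le> f i"
    by (auto simp: enumerates_def)
  then show thesis
    by (rule that)
qed

section \<open>Candidate generators and their rays as faces\<close>

definition pair_ray :: "5 \<Rightarrow> 5 \<Rightarrow> real ^ 5" where
  "pair_ray i j = axis i 1 + axis j 1 + axis 5 1"

text \<open>Four axis vectors and six pair vectors, each arising from several enumerations.\<close>

definition sieve_generators :: "(real ^ 5) set" where
  "sieve_generators = (\<Union>(i, j, k, l) \<in> {(i, j, k, l). enumerates i j k l}. {axis i 1, pair_ray i j})"

lemma enumerates_axis_nth:
  assumes "enumerates i j k l"
  shows "(axis i (1::real) :: real ^ 5) $ i = 1" "(axis i (1::real) :: real ^ 5) $ j = 0"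
    "(axis i (1::real) :: real ^ 5) $ k = 0" "(axis i (1::real) :: real ^ 5) $ l = 0"
    "(axis i (1::real) :: real ^ 5) $ 5 = 0"
  using assms enumerates_neq_5 [OF assms] by (auto simp: enumerates_def axis_def)

lemma enumerates_pair_ray_nth:
  assumes "enumerates i j k l"
  shows "pair_ray i j $ i = 1" "pair_ray i j $ j = 1"
    "pair_ray i j $ k = 0" "pair_ray i j $ l = 0" "pair_ray i j $ 5 = 1"
  using assms enumerates_neq_5 [OF assms] by (auto simp: enumerates_def pair_ray_def axis_def)

lemma sieve_generators_subset: "sieve_generators \<subseteq> sieve_cone - {0}"
proof
  fix g
  assume "g \<in> sieve_generators"
  then obtain i j k l where e: "enumerates i j k l" and g: "g = axis i 1 \<or> g = pair_ray i j"
    by (auto simp: sieve_generators_def)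
  from g show "g \<in> sieve_cone - {0}"
    using enumerates_axis_nth [OF e] enumerates_pair_ray_nth [OF e]
    by (auto simp: sieve_cone_enumerates_iff [OF e] enumerates_vec_eq_iff [OF e])
qed

lemma in_conic_hull_singletonI: "x = c *\<^sub>R g \<Longrightarrow> 0 \<le> c \<Longrightarrow> x \<in> conic hull {g}"
  by (auto simp: conic_hull_explicit)

text \<open>The face is exposed by \<open>q $ j + q $ k + q $ l\<close>: where this sum vanishes,
  the constraint omitting \<open>i\<close> forces \<open>q $ 5 = 0\<close>.\<close>

lemma face_of_sieve_cone_axis:
  assumes e: "enumerates i j k l"
  shows "(conic hull {axis i 1}) face_of sieve_cone"
proof -
  note mem = sieve_cone_enumerates_iff [OF e]
  define f :: "real ^ 5 \<Rightarrow> real" where "f q = q $ j + q $ k + q $ l" for q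
  have "linear f"
    by (rule linearI) (simp_all add: f_def algebra_simps)
  then have face: "(sieve_cone \<inter> {q. f q = 0}) face_of sieve_cone"
    by (rule face_of_Int_linear_zero [OF convex_sieve_cone]) (simp add: f_def mem)
  have "sieve_cone \<inter> {q. f q = 0} = conic hull {axis i 1}"
  proof (intro set_eqI iffI)
    fix q
    assume "q \<in> sieve_cone \<inter> {q. f q = 0}"
    then have q: "q $ j = 0" "q $ k = 0" "q $ l = 0" "q $ 5 = 0" "0 \<le> q $ i"
      unfolding f_def mem Int_iff mem_Collect_eq by linarith+
    then show "q \<in> conic hull {axis i 1}"
      by (intro in_conic_hull_singletonI [where c = "q $ i"])
        (simp_all add: enumerates_vec_eq_iff [OF e] enumerates_axis_nth [OF e])
  next
    fix q
    assume "q \<in> conic hull {axis i (1::real) :: real ^ 5}"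
    then show "q \<in> sieve_cone \<inter> {q. f q = 0}"
      by (auto simp: conic_hull_explicit f_def mem enumerates_axis_nth [OF e])
  qed
  with face show ?thesis by simp
qed

text \<open>The exposing functional adds three nonnegative ones. Once they vanish,
  \<open>q $ i + q $ j = 2 * q $ 5\<close>, while the constraints omitting \<open>i\<close> and
  \<open>j\<close> bound \<open>q $ j\<close> and \<open>q $ i\<close> below by
  \<open>q $ 5\<close>; all three are equal.\<close>

lemma face_of_sieve_cone_pair_ray:
  assumes e: "enumerates i j k l"
  shows "(conic hull {pair_ray i j}) face_of sieve_cone"
proof -
  note mem = sieve_cone_enumerates_iff [OF e]
  define f :: "real ^ 5 \<Rightarrow> real"
    where "f q = (q $ i + q $ j + q $ k + q $ l - 2 * q $ 5) + q $ k + q $ l" for q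
  have "linear f"
    by (rule linearI) (simp_all add: f_def algebra_simps)
  then have face: "(sieve_cone \<inter> {q. f q = 0}) face_of sieve_cone"
    by (rule face_of_Int_linear_zero [OF convex_sieve_cone]) (simp add: f_def mem)
  have "sieve_cone \<inter> {q. f q = 0} = conic hull {pair_ray i j}"
  proof (intro set_eqI iffI)
    fix q
    assume "q \<in> sieve_cone \<inter> {q. f q = 0}"
    then have q: "q $ i = q $ 5" "q $ j = q $ 5" "q $ k = 0" "q $ l = 0" "0 \<le> q $ 5"
      unfolding f_def mem Int_iff mem_Collect_eq by linarith+
    then show "q \<in> conic hull {pair_ray i j}"
      by (intro in_conic_hull_singletonI [where c = "q $ 5"])
        (simp_all add: enumerates_vec_eq_iff [OF e] enumerates_pair_ray_nth [OF e])
  next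
    fix q
    assume "q \<in> conic hull {pair_ray i j}"
    then show "q \<in> sieve_cone \<inter> {q. f q = 0}"
      by (auto simp: conic_hull_explicit f_def mem enumerates_pair_ray_nth [OF e])
  qed
  with face show ?thesis by simp
qed

section \<open>Splitting off a generator\<close>

lemma sieve_cone_split:
  assumes "q \<in> sieve_cone" "q \<noteq> 0"
  shows "\<exists>g\<in>sieve_generators. \<exists>t>0. q - t *\<^sub>R g \<in> sieve_cone"
proof -
  obtain i j k l where e: "enumerates i j k l"
    and ord: "q $ l \<le> q $ k" "q $ k \<le> q $ j" "q $ j \<le> q $ i"
    by (rule sorted_enumeration)
  note mem = sieve_cone_enumerates_iff [OF e]
  have gen: "axis i 1 \<in> sieve_generators" "pair_ray i j \<in> sieve_generators"
    using e by (auto simp: sieve_generators_def)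
  note q = assms(1) [unfolded mem]
  have pos: "0 < q $ i"
  proof (rule ccontr)
    assume "\<not> ?thesis"
    with q ord have "q $ i = 0" "q $ j = 0" "q $ k = 0" "q $ l = 0" "q $ 5 = 0"
      by linarith+
    then show False
      using assms(2) by (simp add: enumerates_vec_eq_iff [OF e])
  qed
  show ?thesis
  proof (cases "2 * q $ 5 < q $ i + q $ j + q $ k + q $ l")
    case True
    \<comment> \<open>These are the slacks that shrink when the axis vector is subtracted; among the
      triple sums containing \<open>q $ i\<close>, the one omitting the large \<open>q $ j\<close>
      is tightest.\<close>
    define t where "t = min (q $ i)
      (min (q $ i + q $ j + q $ k + q $ l - 2 * q $ 5) (q $ i + q $ k + q $ l - q $ 5))"
    \<comment> \<open>Otherwise \<open>q $ i \<le> q $ 5\<close>, while the strict total gives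
      \<open>q $ 5 < q $ j\<close>, contradicting the order.\<close>
    have "0 < q $ i + q $ k + q $ l - q $ 5"
      using True ord q by linarith
    with pos True have "0 < t"
      by (simp add: t_def)
    moreover have "t \<le> q $ i" "t \<le> q $ i + q $ j + q $ k + q $ l - 2 * q $ 5"
      "t \<le> q $ i + q $ k + q $ l - q $ 5"
      by (simp_all add: t_def)
    then have "q - t *\<^sub>R axis i 1 \<in> sieve_cone"
      using q ord by (simp add: mem enumerates_axis_nth [OF e])
    ultimately show ?thesis
      using gen by blast
  next
    case False
    \<comment> \<open>The total and the triple sums omitting \<open>i\<close> or \<open>j\<close>
      keep their slack. As the total is exactly \<open>2 * q $ 5\<close>, the triples omitting
      \<open>k\<close> and \<open>l\<close> have slack \<open>q $ 5 - q $ k\<close> and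
      \<open>q $ 5 - q $ l\<close>; the former is the smaller.\<close>
    define t where "t = min (q $ j) (q $ 5 - q $ k)"
    \<comment> \<open>If \<open>q $ j = 0\<close>, the triple omitting \<open>i\<close> gives
      \<open>q $ 5 = 0\<close>; if \<open>q $ k \<ge> q $ 5\<close>, the total is at least
      \<open>3 * q $ 5\<close>, so again \<open>q $ 5 = 0\<close>. Then the total is 0, against
      \<open>pos\<close>.\<close>
    have "0 < q $ j" "0 < q $ 5 - q $ k"
      using False ord q pos by linarith+
    then have "0 < t"
      by (simp add: t_def)
    moreover have "t \<le> q $ j" "t \<le> q $ 5 - q $ k"
      by (simp_all add: t_def)
    then have "q - t *\<^sub>R pair_ray i j \<in> sieve_cone"
      using q ord False by (simp add: mem enumerates_pair_ray_nth [OF e])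
    ultimately show ?thesis
      using gen by blast
  qed
qed

lemma extremal_rays_sieve_cone:
  "{R. extremal_ray sieve_cone R} = {conic hull {g} | g. g \<in> sieve_generators}"
proof (rule extremal_rays_eqI)
  fix g
  assume "g \<in> sieve_generators"
  then show "(conic hull {g}) face_of sieve_cone"
    using face_of_sieve_cone_axis face_of_sieve_cone_pair_ray by (auto simp: sieve_generators_def)
qed (simp_all add: convex_sieve_cone conic_sieve_cone sieve_generators_subset sieve_cone_split)

section \<open>Generators as permuted coordinate vectors\<close>

lemma permutes_enumerates:
  assumes "p permutes {1, 2, 3, 4 :: 5}"
  obtains i j k l where "enumerates i j k l" "p i = 1" "p j = 2" "p k = 3" "p l = 4" "p 5 = 5"
proof -
  \<comment> \<open>\<open>permute_coords p\<close> reads coordinate \<open>p m\<close> at position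
    \<open>m\<close>, so coordinate 1 lands at \<open>inv p 1\<close>.\<close>
  have "inv p ` {1, 2, 3, 4} = {1, 2, 3, 4}"
    by (rule permutes_image [OF permutes_inv [OF assms]])
  moreover have "distinct [1, 2, 3, 4 :: 5]"
    by simp
  then have "distinct (map (inv p) [1, 2, 3, 4])"
    unfolding distinct_map using permutes_inj_on [OF permutes_inv [OF assms]] by blast
  ultimately have "enumerates (inv p 1) (inv p 2) (inv p 3) (inv p 4)"
    by (simp add: enumerates_def)
  moreover have "p (inv p m) = m" for m
    by (rule permutes_inverses [OF assms])
  moreover have "p 5 = 5"
    by (rule permutes_not_in [OF assms]) simp
  ultimately show thesis
    using that by blast
qed

lemma enumerates_permutes:
  assumes e: "enumerates i j k l"
  obtains p where "p permutes {1, 2, 3, 4 :: 5}" "p i = 1" "p j = 2" "p k = 3" "p l = 4" "p 5 = 5"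
proof -
  define p where "p = id (i := 1, j := 2, k := 3, l := 4)"
  note neq = enumerates_neq_5 [OF e]
  have I: "{1, 2, 3, 4} = {i, j, k, l}" and d: "distinct [i, j, k, l]"
    using e by (simp_all add: enumerates_def)
  have vals: "p i = 1" "p j = 2" "p k = 3" "p l = 4" "p 5 = 5"
    using d neq by (auto simp: p_def)
  have "bij_betw p {i, j, k, l} {1, 2, 3, 4}"
    unfolding bij_betw_def by (auto simp: inj_on_def vals)
  then have "p permutes {1, 2, 3, 4}"
    by (intro bij_imp_permutes) (auto simp: I p_def)
  with vals show thesis
    using that by blast
qed

lemma permute_coords_generators:
  assumes e: "enumerates i j k l" and p: "p i = 1" "p j = 2" "p k = 3" "p l = 4" "p 5 = 5"
  shows "permute_coords p (vector [1, 0, 0, 0, 0]) = axis i 1"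
    "permute_coords p (vector [1, 1, 0, 0, 1]) = pair_ray i j"
  by (simp_all add: enumerates_vec_eq_iff [OF e] permute_coords_def p vector_5
      enumerates_axis_nth [OF e] enumerates_pair_ray_nth [OF e])

lemma sieve_generators_eq:
  "sieve_generators = {permute_coords p w | p w. p permutes {1, 2, 3, 4} \<and>
     w \<in> {vector [1, 0, 0, 0, 0], vector [1, 1, 0, 0, 1]}}" (is "_ = ?G")
proof (intro antisym subsetI)
  fix g
  assume "g \<in> sieve_generators"
  then obtain i j k l where e: "enumerates i j k l" and g: "g = axis i 1 \<or> g = pair_ray i j"
    by (auto simp: sieve_generators_def)
  obtain p where "p permutes {1, 2, 3, 4}" "p i = 1" "p j = 2" "p k = 3" "p l = 4" "p 5 = 5"
    using enumerates_permutes [OF e] .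
  with g have "p permutes {1, 2, 3, 4} \<and>
      (g = permute_coords p (vector [1, 0, 0, 0, 0]) \<or> g = permute_coords p (vector [1, 1, 0, 0, 1]))"
    using permute_coords_generators [OF e, of p] by simp
  then show "g \<in> ?G"
    by blast
next
  fix g
  assume "g \<in> ?G"
  then obtain p w where p: "p permutes {1, 2, 3, 4}" and g: "g = permute_coords p w"
    and w: "w = vector [1, 0, 0, 0, 0] \<or> w = vector [1, 1, 0, 0, 1]"
    by auto
  obtain i j k l where e: "enumerates i j k l"
    and pi: "p i = 1" "p j = 2" "p k = 3" "p l = 4" "p 5 = 5"
    using permutes_enumerates [OF p] .
  show "g \<in> sieve_generators"
    using w permute_coords_generators [OF e pi] e by (auto simp: g sieve_generators_def)
qed

section \<open>Information quantities\<close>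

text \<open>Subsets are split by membership of \<open>x\<close>. As a rewrite rule this expands sums
  over all subsets of an explicit set.\<close>

lemma sum_Pow_insert:
  assumes "finite J" "x \<notin> J"
  shows "sum f (Pow (insert x J)) = sum f (Pow J) + (\<Sum>K\<in>Pow J. f (insert x K))"
proof -
  have "inj_on (insert x) (Pow J)"
    using assms(2) by (auto simp: inj_on_def)
  then have "sum f (insert x ` Pow J) = (\<Sum>K\<in>Pow J. f (insert x K))"
    by (simp add: sum.reindex)
  then show ?thesis
    unfolding Pow_insert using assms by (subst sum.union_disjoint) auto
qed

text \<open>No index represents the empty set, so the empty set may be added to the sum defining
  \<open>multi_info\<close>.\<close>

lemma S_empty: "S {} = 0"
  using Rep_subsystem by (auto simp: S_def vec_eq_iff)

lemma multi_info_eq_sum_Pow: "multi_info J = (\<Sum>K\<in>Pow J. (-1) ^ (card K + 1) *\<^sub>R S K)"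
  unfolding multi_info_def by (rule sum.mono_neutral_left) (auto simp: S_empty)

lemma info_quantity_first_ray:
  "info_quantity (vector [1, 0, 0, 0, 0]) = - tripartite_info {A} {B} {C}"
  by (simp add: info_quantity_def vector_5 tripartite_info_def multi_info_eq_sum_Pow sum_Pow_insert
      S_empty insert_commute algebra_simps)

text \<open>This is the recursion I4(A:B:C:D) = I3(A:B:C) + I3(A:B:D) - I3(A:B:CD), checked by
  expanding both sides in the basis \<open>S\<close>.\<close>

lemma info_quantity_second_ray:
  "info_quantity (vector [1, 1, 0, 0, 1]) = - tripartite_info {C, D} {A} {B}"
  by (simp add: info_quantity_def vector_5 tripartite_info_def multi_info_eq_sum_Pow sum_Pow_insert
      S_empty insert_commute algebra_simps)

theorem mainTheorem10:
  shows "{R. extremal_ray sieve_cone R} =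
      {conic hull {permute_coords p w} | p w.
        p permutes {1, 2, 3, 4} \<and> w \<in> {vector [1, 0, 0, 0, 0], vector [1, 1, 0, 0, 1]}} \<and>
    info_quantity (vector [1, 0, 0, 0, 0]) = - tripartite_info {A} {B} {C} \<and>
    info_quantity (vector [1, 1, 0, 0, 1]) = - tripartite_info {C, D} {A} {B} \<and>
    mmi_instance (info_quantity (vector [1, 0, 0, 0, 0])) \<and>
    mmi_instance (info_quantity (vector [1, 1, 0, 0, 1]))"
proof (intro conjI)
  show "{R. extremal_ray sieve_cone R} =
      {conic hull {permute_coords p w} | p w.
        p permutes {1, 2, 3, 4} \<and> w \<in> {vector [1, 0, 0, 0, 0], vector [1, 1, 0, 0, 1]}}"
    unfolding extremal_rays_sieve_cone sieve_generators_eq by blast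
  show "mmi_instance (info_quantity (vector [1, 0, 0, 0, 0]))"
    unfolding mmi_instance_def info_quantity_first_ray
    by (intro exI [of _ "{A}"] exI [of _ "{B}"] exI [of _ "{C}"]) simp
  show "mmi_instance (info_quantity (vector [1, 1, 0, 0, 1]))"
    unfolding mmi_instance_def info_quantity_second_ray
    by (intro exI [of _ "{C, D}"] exI [of _ "{A}"] exI [of _ "{B}"]) simp
qed (rule info_quantity_first_ray info_quantity_second_ray)+

end
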